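(* Restricted to instances with $I_f=I_1$ (i.e. every follower's edge is mandatory, so $I_0=I_*=\emptyset$), the decision problem RP(Max-M) (the response problem for maximum-weight matching on general graphs) is solvable in polynomial time.
   Context: RP(Max-M) is the following decision problem. Given: a finite undirected graph $G=(V,E)$, a partition $E=I_\ell\,\dot\cup\,I_f$ of its edge set into leader's edges $I_\ell$ and follower's edges $I_f$, a follower's weight function $d\colon I_f\to\mathbb{Q}$, and a partition $I_f=I_0\,\dot\cup\,I_1\,\dot\cup\,I_*$ into forbidden edges $I_0$, mandatory edges $I_1$ and neutral edges $I_*$ (parts may be empty). For $X\subseteq I_\ell$, a feasible follower's reaction to $X$ is a set $Y\subseteq I_f$ such that $X\cup Y$ is a matching of $G$; it is an optimal reaction if it maximizes $d(Y)=\sum_{e\in Y}d(e)$ among all feasible reactions to $X$. Question: does there exist $X\subseteq I_\ell$ for which there is an optimal follower's reaction $Y$ to $X$ with $I_0\cap Y=\emptyset$ and $I_1\subseteq Y$? (This is the optimistic setting.) *)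

theory Defs
  imports "HOL-Computational_Algebra.Polynomial"
begin

section \<open>Deterministic multi-tape Turing machines and polynomial time\<close>

text \<open>
  The input alphabet is a finite type \<open>'s\<close>; a tape cell holds an input symbol or the blank \<open>None\<close>.
  The states are the numbers below \<open>tm_states\<close>, and the values of \<open>tm_trans\<close> matter only for such
  states and for lists of \<open>tm_tapes\<close> many scanned symbols, so that a machine is a finite object.
\<close>

datatype direction = Go_Left | Stay | Go_Right

record 's tm =
  tm_tapes :: nat
  tm_states :: nat
  tm_start :: nat
  tm_accept :: nat
  tm_reject :: nat
  tm_trans :: "nat \<Rightarrow> 's option list \<Rightarrow> nat \<times> ('s option \<times> direction) list"

definition wf_tm :: "('s::finite) tm \<Rightarrow> bool" where
  "wf_tm M \<longleftrightarrow>
     0 < tm_tapes M \<and>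
     tm_start M < tm_states M \<and> tm_accept M < tm_states M \<and> tm_reject M < tm_states M \<and>
     tm_accept M \<noteq> tm_reject M \<and>
     (\<forall>q xs. q < tm_states M \<longrightarrow> length xs = tm_tapes M \<longrightarrow>
        fst (tm_trans M q xs) < tm_states M \<and> length (snd (tm_trans M q xs)) = tm_tapes M)"

text \<open>Tapes are infinite in both directions; a tape is its contents with the head position.\<close>

type_synonym 's tape = "(int \<Rightarrow> 's option) \<times> int"

type_synonym 's config = "nat \<times> 's tape list"

fun move_head :: "direction \<Rightarrow> int \<Rightarrow> int" where
  "move_head Go_Left h = h - 1"
| "move_head Stay h = h"
| "move_head Go_Right h = h + 1"

fun scanned :: "'s tape \<Rightarrow> 's option" where
  "scanned (c, h) = c h"

fun act :: "'s option \<times> direction \<Rightarrow> 's tape \<Rightarrow> 's tape" where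
  "act (s, m) (c, h) = (c(h := s), move_head m h)"

fun tm_step :: "'s tm \<Rightarrow> 's config \<Rightarrow> 's config" where
  "tm_step M (q, ts) =
     (if q = tm_accept M \<or> q = tm_reject M then (q, ts)
      else (let (q', as) = tm_trans M q (map scanned ts) in (q', map2 act as ts)))"

definition blank_tape :: "'s tape" where
  "blank_tape = ((\<lambda>_. None), 0)"

definition input_tape :: "'s list \<Rightarrow> 's tape" where
  "input_tape w = ((\<lambda>i. if 0 \<le> i \<and> i < int (length w) then Some (w ! nat i) else None), 0)"

definition tm_init :: "'s tm \<Rightarrow> 's list \<Rightarrow> 's config" where
  "tm_init M w = (tm_start M, input_tape w # replicate (tm_tapes M - 1) blank_tape)"

definition state_after :: "'s tm \<Rightarrow> 's list \<Rightarrow> nat \<Rightarrow> nat" where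
  "state_after M w t = fst ((tm_step M ^^ t) (tm_init M w))"

text \<open>
  A decision problem consists of a set of instances, a relation saying which words encode an
  instance, and the predicate that holds for the yes-instances.
\<close>

definition poly_time_solvable ::
  "'i set \<Rightarrow> ('i \<Rightarrow> ('s::finite) list \<Rightarrow> bool) \<Rightarrow> ('i \<Rightarrow> bool) \<Rightarrow> bool" where
  "poly_time_solvable Inst encodes yes \<longleftrightarrow>
     (\<exists>(M :: 's tm) (p :: nat poly). wf_tm M \<and>
        (\<forall>J\<in>Inst. \<forall>w. encodes J w \<longrightarrow>
           (\<exists>t \<le> poly p (length w).
              state_after M w t = (if yes J then tm_accept M else tm_reject M))))"


section \<open>The response problem for maximum-weight matching\<close>

text \<open>Only the values of \<open>weight\<close> on the follower's edges are part of an instance.\<close>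

record 'v rp_instance =
  verts :: "'v set"
  edges :: "'v set set"
  leader_edges :: "'v set set"
  follower_edges :: "'v set set"
  weight :: "'v set \<Rightarrow> rat"
  forbidden :: "'v set set"
  mandatory :: "'v set set"
  neutral :: "'v set set"

definition rp_valid :: "'v rp_instance \<Rightarrow> bool" where
  "rp_valid J \<longleftrightarrow>
     finite (verts J) \<and>
     (\<forall>e\<in>edges J. e \<subseteq> verts J \<and> card e = 2) \<and>
     edges J = leader_edges J \<union> follower_edges J \<and>
     leader_edges J \<inter> follower_edges J = {} \<and>
     follower_edges J = forbidden J \<union> mandatory J \<union> neutral J \<and>
     forbidden J \<inter> mandatory J = {} \<and>
     forbidden J \<inter> neutral J = {} \<and>
     mandatory J \<inter> neutral J = {}"

definition is_matching :: "'v set set \<Rightarrow> 'v set set \<Rightarrow> bool" where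
  "is_matching E N \<longleftrightarrow> N \<subseteq> E \<and> pairwise disjnt N"

definition feasible_reaction :: "'v rp_instance \<Rightarrow> 'v set set \<Rightarrow> 'v set set \<Rightarrow> bool" where
  "feasible_reaction J X Y \<longleftrightarrow> Y \<subseteq> follower_edges J \<and> is_matching (edges J) (X \<union> Y)"

definition optimal_reaction :: "'v rp_instance \<Rightarrow> 'v set set \<Rightarrow> 'v set set \<Rightarrow> bool" where
  "optimal_reaction J X Y \<longleftrightarrow>
     feasible_reaction J X Y \<and>
     (\<forall>Y'. feasible_reaction J X Y' \<longrightarrow> sum (weight J) Y' \<le> sum (weight J) Y)"

definition rp_yes :: "'v rp_instance \<Rightarrow> bool" where
  "rp_yes J \<longleftrightarrow>
     (\<exists>X \<subseteq> leader_edges J. \<exists>Y. optimal_reaction J X Y \<and>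
        forbidden J \<inter> Y = {} \<and> mandatory J \<subseteq> Y)"


section \<open>Encoding of instances\<close>

datatype rp_symbol =
  Bit0 | Bit1 | Vertex_Tag | Leader_Tag | Forbidden_Tag | Mandatory_Tag | Neutral_Tag
  | Sep | Minus | Slash

instance rp_symbol :: finite
proof
  have "(UNIV :: rp_symbol set) \<subseteq>
    {Bit0, Bit1, Vertex_Tag, Leader_Tag, Forbidden_Tag, Mandatory_Tag, Neutral_Tag, Sep, Minus, Slash}"
  proof
    fix x :: rp_symbol
    show "x \<in> {Bit0, Bit1, Vertex_Tag, Leader_Tag, Forbidden_Tag, Mandatory_Tag, Neutral_Tag,
      Sep, Minus, Slash}"
      by (cases x) simp_all
  qed
  then show "finite (UNIV :: rp_symbol set)"
    by (rule finite_subset) simp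
qed

text \<open>Binary, most significant bit first, without leading zeros (and \<open>[Bit0]\<close> for 0).\<close>

fun enc_nat :: "nat \<Rightarrow> rp_symbol list" where
  "enc_nat n = (if n < 2 then [] else enc_nat (n div 2)) @ [if odd n then Bit1 else Bit0]"

declare enc_nat.simps [simp del]

definition enc_rat :: "rat \<Rightarrow> rp_symbol list" where
  "enc_rat r = (case quotient_of r of (a, b) \<Rightarrow>
     (if a < 0 then [Minus] else []) @ enc_nat (nat \<bar>a\<bar>) @ [Slash] @ enc_nat (nat b))"

definition edge_tag :: "'v rp_instance \<Rightarrow> 'v set \<Rightarrow> rp_symbol" where
  "edge_tag J e =
     (if e \<in> leader_edges J then Leader_Tag
      else if e \<in> forbidden J then Forbidden_Tag
      else if e \<in> mandatory J then Mandatory_Tag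
      else Neutral_Tag)"

definition enc_vertex :: "nat \<Rightarrow> rp_symbol list" where
  "enc_vertex v = Vertex_Tag # enc_nat v"

fun enc_edge :: "nat rp_instance \<Rightarrow> nat \<times> nat \<Rightarrow> rp_symbol list" where
  "enc_edge J (u, v) =
     [edge_tag J {u, v}] @ enc_nat u @ [Sep] @ enc_nat v @
     (if {u, v} \<in> follower_edges J then [Sep] @ enc_rat (weight J {u, v}) else [])"

text \<open>
  An encoding lists the vertices and then the edges, each exactly once. The order of the two lists
  and the order of the two endpoints of each edge are arbitrary, so an instance has several encodings.
\<close>

definition rp_encodes :: "nat rp_instance \<Rightarrow> rp_symbol list \<Rightarrow> bool" where
  "rp_encodes J w \<longleftrightarrow>
     (\<exists>vs es.
        distinct vs \<and> set vs = verts J \<and>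
        distinct (map (\<lambda>(u, v). {u, v}) es) \<and> (\<lambda>(u, v). {u, v}) ` set es = edges J \<and>
        w = concat (map enc_vertex vs) @ concat (map (enc_edge J) es))"

lemma rp_encodes_exists:
  assumes "rp_valid J"
  shows "\<exists>w. rp_encodes J w"
proof -
  have fin: "finite (verts J)" and card2: "\<forall>e\<in>edges J. e \<subseteq> verts J \<and> card e = 2"
    using assms by (auto simp: rp_valid_def)
  obtain vs where vs: "set vs = verts J" "distinct vs"
    using finite_distinct_list [OF fin] by blast
  have "edges J \<subseteq> Pow (verts J)"
    using card2 by blast
  then have "finite (edges J)"
    using fin by (meson finite_Pow_iff finite_subset)
  then obtain xs where xs: "set xs = edges J" "distinct xs"
    using finite_distinct_list by blast
  have "\<forall>e\<in>edges J. \<exists>u v. {u, v} = e"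
    using card2 by (metis card_2_iff)
  then obtain f g where fg: "\<forall>e\<in>edges J. {f e, g e} = e"
    by metis
  define es where "es = map (\<lambda>e. (f e, g e)) xs"
  have "map (\<lambda>(u, v). {u, v}) es = xs"
    unfolding es_def map_map by (rule map_idI) (use fg xs in auto)
  then have "distinct (map (\<lambda>(u, v). {u, v}) es)"
    and "(\<lambda>(u, v). {u, v}) ` set es = edges J"
    using xs by (simp_all flip: set_map)
  then show ?thesis
    unfolding rp_encodes_def using vs by blast
qed

end

theory Submission
  imports Defs
begin

text \<open>
  If every follower's edge is mandatory, the follower has to take all of them, and then every subset
  of the follower's edges is a feasible reaction as well. Hence the leader's choice is irrelevant: the
  answer is yes iff the mandatory edges are pairwise disjoint and none of them has negative weight
  (\<open>rp_yes_iff\<close>). In an encoding this means that the symbol \<open>Minus\<close> does not occur and that the binary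
  names of the endpoints of the mandatory edges are distinct words.

  A three-tape machine decides this in quadratic time. While reading the input once, it
  rejects at a \<open>Minus\<close> and writes the names \<open>x\<^sub>1, x\<^sub>2, \<dots>\<close> as \<open>Sep x\<^sub>1 Sep x\<^sub>2 Sep \<dots>\<close> to both work tapes
  (\<open>read_encoding\<close>, \<open>run_reading\<close>). Two of the names are equal iff this word has a self-overlap in which
  two occurrences of the same factor \<open>Sep x Sep\<close> lie over each other, shifted by some \<open>s > 0\<close>
  (\<open>distinct_iff_no_shift_match\<close>). For a fixed shift, a finite automaton sees this when it reads both
  copies in parallel, so no nested comparison of words is needed: the machine does one sweep to the
  right and one back for every shift (\<open>run_shifts\<close>).
\<close>

section \<open>The response problem with mandatory edges only\<close>

text \<open>
  A negative mandatory edge could be dropped from the reaction, which would improve it. Conversely, the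
  witness is \<open>X = {}\<close>: every reaction is a subset of the mandatory edges, and enlarging a set of edges of
  nonnegative weight does not decrease its weight.
\<close>

lemma rp_yes_iff:
  assumes valid: "rp_valid J" and mand: "follower_edges J = mandatory J"
  shows "rp_yes J \<longleftrightarrow> pairwise disjnt (mandatory J) \<and> (\<forall>e\<in>mandatory J. 0 \<le> weight J e)"
proof
  have fin: "finite (mandatory J)"
  proof -
    have "mandatory J \<subseteq> Pow (verts J)" "finite (verts J)"
      using valid by (auto simp: rp_valid_def)
    then show ?thesis
      by (meson finite_Pow_iff finite_subset)
  qed
  {
    assume "rp_yes J"
    then obtain X Y where opt: "optimal_reaction J X Y" and "mandatory J \<subseteq> Y"
      by (auto simp: rp_yes_def)
    then have Y: "Y = mandatory J"
      using mand by (auto simp: optimal_reaction_def feasible_reaction_def)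
    have match: "is_matching (edges J) (X \<union> mandatory J)"
      using opt Y by (auto simp: optimal_reaction_def feasible_reaction_def)
    have "0 \<le> weight J e" if e: "e \<in> mandatory J" for e
    proof -
      have "feasible_reaction J X (mandatory J - {e})"
        using match mand
        by (auto simp: feasible_reaction_def is_matching_def intro: pairwise_subset)
      then have "sum (weight J) (mandatory J - {e}) \<le> sum (weight J) (mandatory J)"
        using opt Y by (auto simp: optimal_reaction_def)
      then show ?thesis
        using sum.remove [OF fin e, of "weight J"] by simp
    qed
    moreover have "pairwise disjnt (mandatory J)"
      using match by (auto simp: is_matching_def intro: pairwise_subset)
    ultimately show "pairwise disjnt (mandatory J) \<and> (\<forall>e\<in>mandatory J. 0 \<le> weight J e)"
      by blast
  }
  assume *: "pairwise disjnt (mandatory J) \<and> (\<forall>e\<in>mandatory J. 0 \<le> weight J e)"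
  have "optimal_reaction J {} (mandatory J)"
    unfolding optimal_reaction_def feasible_reaction_def is_matching_def
    using * mand valid fin by (auto simp: rp_valid_def intro!: sum_mono2)
  moreover have "forbidden J \<inter> mandatory J = {}"
    using valid by (simp add: rp_valid_def)
  ultimately show "rp_yes J"
    unfolding rp_yes_def by blast
qed

fun endpoints :: "'v rp_instance \<Rightarrow> ('v \<times> 'v) list \<Rightarrow> 'v list" where
  "endpoints J [] = []"
| "endpoints J ((u, v) # es) = (if {u, v} \<in> mandatory J then [u, v] else []) @ endpoints J es"

lemma set_endpoints:
  "set (endpoints J es) = \<Union> (mandatory J \<inter> (\<lambda>(u, v). {u, v}) ` set es)"
  by (induction J es rule: endpoints.induct) auto

text \<open>
  This turns disjointness of the mandatory edges into distinctness of one list. A mandatory edge that is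
  listed twice, or a mandatory loop, would repeat an endpoint without violating disjointness.
\<close>

lemma distinct_endpoints_iff:
  assumes "distinct (map (\<lambda>(u, v). {u, v}) es)" and "\<forall>(u, v)\<in>set es. u \<noteq> v"
  shows "distinct (endpoints J es) \<longleftrightarrow>
    pairwise disjnt (mandatory J \<inter> (\<lambda>(u, v). {u, v}) ` set es)"
  using assms
proof (induction J es rule: endpoints.induct)
  case (2 J u v es)
  let ?E = "mandatory J \<inter> (\<lambda>(u, v). {u, v}) ` set es"
  have IH: "distinct (endpoints J es) \<longleftrightarrow> pairwise disjnt ?E"
    using 2 by simp
  show ?case
  proof (cases "{u, v} \<in> mandatory J")
    case True
    have new: "{u, v} \<notin> ?E"
      using "2.prems"(1) by simp
    have "distinct (endpoints J ((u, v) # es)) \<longleftrightarrow>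
        (\<forall>e\<in>?E. disjnt {u, v} e) \<and> pairwise disjnt ?E"
    proof -
      have "(\<forall>e\<in>E. disjnt {u, v} e) \<longleftrightarrow> u \<notin> \<Union> E \<and> v \<notin> \<Union> E" for E
        by (auto simp: disjnt_def)
      then have "(\<forall>e\<in>?E. disjnt {u, v} e) \<longleftrightarrow> u \<notin> set (endpoints J es) \<and> v \<notin> set (endpoints J es)"
        unfolding set_endpoints .
      moreover have "distinct (endpoints J ((u, v) # es)) \<longleftrightarrow>
          (u \<notin> set (endpoints J es) \<and> v \<notin> set (endpoints J es)) \<and> distinct (endpoints J es)"
        using True "2.prems"(2) by simp
      ultimately show ?thesis
        unfolding IH by (simp only:)
    qed
    also have "\<dots> \<longleftrightarrow> pairwise disjnt (insert {u, v} ?E)"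
    proof -
      have "(\<forall>e'\<in>E. disjnt e e') \<and> pairwise disjnt E \<longleftrightarrow> pairwise disjnt (insert e E)"
        if "e \<notin> E" for e and E :: "'a set set"
        unfolding pairwise_insert using that by (metis disjnt_sym)
      from this [OF new] show ?thesis .
    qed
    also have "insert {u, v} ?E = mandatory J \<inter> (\<lambda>(u, v). {u, v}) ` set ((u, v) # es)"
      using True by auto
    finally show ?thesis .
  next
    case False
    then show ?thesis
      using IH by (simp add: Int_insert_right)
  qed
qed simp


section \<open>Detecting a repeated block by shifting\<close>

text \<open>
  These are the states of the machine. \<open>First\<close> and \<open>Second\<close> read the two endpoints of a mandatory edge,
  and \<open>Skip\<close> reads everything else, weights included; \<open>Unaligned\<close> and \<open>Aligned\<close> compare the two copies.
\<close>

datatype phase =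
  Start | Skip | First | Second | Rewind | Shift | Unaligned | Aligned | Accept | Reject

definition blocks :: "rp_symbol list list \<Rightarrow> rp_symbol list" where
  "blocks ws = concat (map (\<lambda>x. x @ [Sep]) ws)"

lemma blocks_simps [simp]:
  "blocks [] = []"
  "blocks (x # ws) = x @ Sep # blocks ws"
  "blocks (ws @ ws') = blocks ws @ blocks ws'"
  by (simp_all add: blocks_def)

text \<open>
  The automaton for one sweep reads pairs of symbols. It is in the phase \<open>Aligned\<close> while both copies have
  agreed ever since a common separator, so that another common separator ends two equal blocks.
\<close>

fun compare :: "phase \<Rightarrow> rp_symbol \<times> rp_symbol \<Rightarrow> phase" where
  "compare Unaligned (a, b) = (if a = Sep \<and> b = Sep then Aligned else Unaligned)"
| "compare Aligned (a, b) = (if a \<noteq> b then Unaligned else if a = Sep then Reject else Aligned)"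
| "compare q _ = q"

definition block_match :: "(rp_symbol \<times> rp_symbol) list \<Rightarrow> bool" where
  "block_match zs \<longleftrightarrow>
    (\<exists>xs w ys. zs = xs @ [(Sep, Sep)] @ map (\<lambda>b. (b, b)) w @ [(Sep, Sep)] @ ys \<and> Sep \<notin> set w)"

lemma block_match_append: "block_match zs \<Longrightarrow> block_match (zs @ zs')"
  unfolding block_match_def by (metis append.assoc)

lemma foldl_compare_Reject [simp]: "foldl compare Reject zs = Reject"
  by (induction zs) auto

lemma foldl_compare_Aligned [simp]:
  "Sep \<notin> set w \<Longrightarrow> foldl compare Aligned (map (\<lambda>b. (b, b)) w) = Aligned"
  by (induction w) auto

lemma foldl_compare_cases:
  "foldl compare Unaligned zs = Unaligned \<or>
   (foldl compare Unaligned zs = Aligned \<and>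
     (\<exists>xs w. zs = xs @ [(Sep, Sep)] @ map (\<lambda>b. (b, b)) w \<and> Sep \<notin> set w)) \<or>
   (foldl compare Unaligned zs = Reject \<and> block_match zs)"
proof (induction zs rule: rev_induct)
  case (snoc z zs)
  obtain a b where z: "z = (a, b)"
    by (cases z)
  from snoc show ?case
  proof (elim disjE conjE exE)
    assume "foldl compare Unaligned zs = Unaligned"
    moreover have "\<exists>xs w. zs @ [(Sep, Sep)] = xs @ [(Sep, Sep)] @ map (\<lambda>b. (b, b)) w \<and> Sep \<notin> set w"
      by (rule exI [of _ zs], rule exI [of _ "[]"]) simp
    ultimately show ?thesis
      unfolding z by (cases "a = Sep \<and> b = Sep") (simp_all del: append_Cons)
  next
    fix xs w
    assume al: "foldl compare Unaligned zs = Aligned"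
      and zs: "zs = xs @ [(Sep, Sep)] @ map (\<lambda>b. (b, b)) w" and w: "Sep \<notin> set w"
    consider "a \<noteq> b" | "a = b" "a = Sep" | "a = b" "a \<noteq> Sep"
      by blast
    then show ?thesis
    proof cases
      case 1
      then show ?thesis
        using al z by simp
    next
      case 2
      then have "zs @ [z] = xs @ [(Sep, Sep)] @ map (\<lambda>b. (b, b)) w @ [(Sep, Sep)] @ []"
        using zs z by simp
      then have "block_match (zs @ [z])"
        unfolding block_match_def using w by blast
      then show ?thesis
        using 2 al z by simp
    next
      case 3
      then have "zs @ [z] = xs @ [(Sep, Sep)] @ map (\<lambda>b. (b, b)) (w @ [a]) \<and> Sep \<notin> set (w @ [a])"
        using zs z w by simp
      moreover have "foldl compare Unaligned (zs @ [z]) = Aligned"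
        using 3 al z by simp
      ultimately show ?thesis
        by blast
    qed
  next
    assume "foldl compare Unaligned zs = Reject" "block_match zs"
    then show ?thesis
      by (cases z) (auto intro: block_match_append)
  qed
qed simp

lemma foldl_compare_range: "foldl compare Unaligned zs \<in> {Unaligned, Aligned, Reject}"
  using foldl_compare_cases [of zs] by auto

text \<open>
  A match is never lost, although other separators may precede it: a common separator makes the
  automaton aligned or, if it was aligned already, lets it reject.
\<close>

lemma foldl_compare_eq_Reject_iff: "foldl compare Unaligned zs = Reject \<longleftrightarrow> block_match zs"
proof
  assume "block_match zs"
  then obtain xs w ys where
    zs: "zs = xs @ [(Sep, Sep)] @ map (\<lambda>b. (b, b)) w @ [(Sep, Sep)] @ ys" and w: "Sep \<notin> set w"
    unfolding block_match_def by blast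
  have "foldl compare Unaligned (xs @ [(Sep, Sep)]) \<in> {Aligned, Reject}"
    using foldl_compare_range [of xs] by auto
  then show "foldl compare Unaligned zs = Reject"
    unfolding zs using w by auto
next
  show "foldl compare Unaligned zs = Reject \<Longrightarrow> block_match zs"
    using foldl_compare_cases [of zs] by auto
qed

lemma eq_up_to_first_separator:
  "a \<notin> set x \<Longrightarrow> a \<notin> set y \<Longrightarrow> x @ a # r = y @ a # r' \<Longrightarrow> x = y"
proof (induction x arbitrary: y)
  case Nil
  then show ?case
    by (cases y) auto
next
  case (Cons b x)
  then show ?case
    by (cases y) auto
qed

text \<open>
  Since neither \<open>w\<close> nor the blocks contain a separator, a factor \<open>Sep w Sep\<close> encloses exactly
  one block. The second conclusion ties the position of the factor to the position of \<open>w\<close> in the list.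
\<close>

lemma block_occurrence:
  assumes "\<forall>x\<in>set ws. Sep \<notin> set x" and "Sep \<notin> set w"
    and "Sep # blocks ws = A @ [Sep] @ w @ [Sep] @ B"
  shows "\<exists>ws1 ws2. ws = ws1 @ w # ws2 \<and> A @ [Sep] = Sep # blocks ws1"
  using assms
proof (induction ws arbitrary: A)
  case Nil
  then show ?case
    by (cases A) auto
next
  case (Cons x ws)
  show ?case
  proof (cases A)
    case Nil
    then have "x @ Sep # blocks ws = w @ Sep # B"
      using Cons.prems by simp
    then have "x = w"
      using Cons.prems by (auto elim: eq_up_to_first_separator [rotated 2])
    then show ?thesis
      using Nil by (intro exI [of _ "[]"] exI [of _ ws]) simp
  next
    case (Cons a A')
    then have a: "a = Sep" and eq: "x @ Sep # blocks ws = A' @ Sep # w @ Sep # B"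
      using Cons.prems by auto
    (* The block x has no separator, so the separator before w is not inside x. *)
    have "\<exists>A''. A' = x @ A'' \<and> Sep # blocks ws = A'' @ [Sep] @ w @ [Sep] @ B"
    proof -
      have x: "Sep \<notin> set x"
        using Cons.prems by simp
      from eq obtain us where
        "x = A' @ us \<and> us @ Sep # blocks ws = Sep # w @ Sep # B \<or>
         x @ us = A' \<and> Sep # blocks ws = us @ Sep # w @ Sep # B"
        by (auto simp: append_eq_append_conv2)
      then show ?thesis
      proof (elim disjE conjE)
        assume "x = A' @ us" "us @ Sep # blocks ws = Sep # w @ Sep # B"
        moreover from this have "us = []"
          using x by (cases us) auto
        ultimately show ?thesis
          by (intro exI [of _ "[]"]) simp
      qed auto
    qed
    then obtain A'' where A'': "A' = x @ A''" "Sep # blocks ws = A'' @ [Sep] @ w @ [Sep] @ B"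
      by blast
    then obtain ws1 ws2 where "ws = ws1 @ w # ws2" "A'' @ [Sep] = Sep # blocks ws1"
      using Cons.IH [of A''] Cons.prems by auto
    then show ?thesis
      using Cons a A'' by (intro exI [of _ "x # ws1"] exI [of _ ws2]) simp
  qed
qed

lemma zip_common_factor:
  assumes "zip us vs = xs @ map (\<lambda>b. (b, b)) w @ ys"
  shows "\<exists>A B A' B'. us = A @ w @ B \<and> vs = A' @ w @ B' \<and> length A = length xs \<and> length A' = length xs"
proof -
  obtain A us' A' vs' where 1: "us = A @ us'" "vs = A' @ vs'" "length A = length xs"
      "length A' = length xs" "zip us' vs' = map (\<lambda>b. (b, b)) w @ ys"
  proof
    have len: "length xs \<le> length us" "length xs \<le> length vs"
      using arg_cong [OF assms, of length] by auto
    show "us = take (length xs) us @ drop (length xs) us"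
      "vs = take (length xs) vs @ drop (length xs) vs"
      by simp_all
    show "length (take (length xs) us) = length xs" "length (take (length xs) vs) = length xs"
      using len by simp_all
    show "zip (drop (length xs) us) (drop (length xs) vs) = map (\<lambda>b. (b, b)) w @ ys"
      using arg_cong [OF assms, of "drop (length xs)"] by (simp add: drop_zip)
  qed
  have "\<exists>B B'. us' = w @ B \<and> vs' = w @ B'"
    using 1(5)
  proof (induction w arbitrary: us' vs')
    case (Cons a w)
    then show ?case
      by (cases us'; cases vs') auto
  qed simp
  then show ?thesis
    using 1 by blast
qed

text \<open>
  The leading separator gives every block the form \<open>Sep x Sep\<close>. In one direction, two occurrences of such
  a factor at different positions are occurrences as different list entries; in the other direction
  the shift is the distance between two equal entries.
\<close>

lemma distinct_iff_no_shift_match: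
  assumes "\<forall>x\<in>set ws. Sep \<notin> set x"
  defines "u \<equiv> Sep # blocks ws"
  shows "distinct ws \<longleftrightarrow> (\<forall>s. 0 < s \<and> s < length u \<longrightarrow> \<not> block_match (zip u (drop s u)))"
proof
  assume dist: "distinct ws"
  show "\<forall>s. 0 < s \<and> s < length u \<longrightarrow> \<not> block_match (zip u (drop s u))"
  proof (intro allI impI notI)
    fix s assume s: "0 < s \<and> s < length u" and "block_match (zip u (drop s u))"
    then obtain xs w ys where
      "zip u (drop s u) = xs @ [(Sep, Sep)] @ map (\<lambda>b. (b, b)) w @ [(Sep, Sep)] @ ys"
      and w: "Sep \<notin> set w"
      unfolding block_match_def by blast
    then have "zip u (drop s u) = xs @ map (\<lambda>b. (b, b)) ([Sep] @ w @ [Sep]) @ ys"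
      by simp
    then obtain A B A' B' where 1: "u = A @ ([Sep] @ w @ [Sep]) @ B"
      and drop: "drop s u = A' @ ([Sep] @ w @ [Sep]) @ B'"
      and len: "length A = length xs" "length A' = length xs"
      using zip_common_factor [of u "drop s u" xs "[Sep] @ w @ [Sep]" ys] by auto
    have 2: "u = (take s u @ A') @ ([Sep] @ w @ [Sep]) @ B'"
      using drop by (metis append.assoc append_take_drop_id)
    obtain ws1 ws2 where ws: "ws = ws1 @ w # ws2" "A @ [Sep] = Sep # blocks ws1"
      using block_occurrence [OF assms(1) w, of A B] 1 unfolding u_def by auto
    obtain ws1' ws2' where ws': "ws = ws1' @ w # ws2'" "(take s u @ A') @ [Sep] = Sep # blocks ws1'"
      using block_occurrence [OF assms(1) w, of "take s u @ A'" B'] 2 unfolding u_def by auto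
    have "w \<notin> set ws1" "w \<notin> set ws2"
      using dist ws(1) by auto
    then have "ws1 = ws1'"
      using append_Cons_eq_iff [of w ws1 ws2 ws1' ws2'] ws(1) ws'(1) by simp
    then have "length (take s u @ A') = length A"
      using ws(2) ws'(2) by (metis append_same_eq)
    then show False
      using s len by simp
  qed
next
  assume no: "\<forall>s. 0 < s \<and> s < length u \<longrightarrow> \<not> block_match (zip u (drop s u))"
  show "distinct ws"
  proof (rule ccontr)
    assume "\<not> distinct ws"
    then obtain as bs cs x where ws: "ws = as @ [x] @ bs @ [x] @ cs"
      using not_distinct_decomp by blast
    have last: "\<exists>A. Sep # blocks zs = A @ [Sep]" for zs
      by (induction zs rule: rev_induct) auto
    obtain A where A: "Sep # blocks as = A @ [Sep]"
      using last by blast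
    obtain D where D: "Sep # blocks (as @ [x] @ bs) = D @ [Sep]"
      using last by blast
    define s where "s = length (blocks ([x] @ bs))"
    have D_len: "length D = s + length A"
      using arg_cong [OF D, of length] arg_cong [OF A, of length] by (simp add: s_def)
    have u1: "u = A @ ([Sep] @ x @ [Sep]) @ blocks (bs @ [x] @ cs)"
      using A by (simp add: u_def ws)
    have "u = (Sep # blocks (as @ [x] @ bs)) @ x @ [Sep] @ blocks cs"
      by (simp add: u_def ws)
    then have u2: "u = D @ ([Sep] @ x @ [Sep]) @ blocks cs"
      unfolding D by simp
    have drop: "drop s u = drop s D @ ([Sep] @ x @ [Sep]) @ blocks cs"
      using D_len unfolding u2 by simp
    have "zip x x = map (\<lambda>b. (b, b)) x"
      by (induction x) auto
    then have "zip u (drop s u) = zip A (drop s D) @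
        [(Sep, Sep)] @ map (\<lambda>b. (b, b)) x @ [(Sep, Sep)] @ zip (blocks (bs @ [x] @ cs)) (blocks cs)"
      unfolding drop by (subst u1) (simp add: D_len)
    moreover have "Sep \<notin> set x"
      using assms(1) ws by simp
    ultimately have "block_match (zip u (drop s u))"
      unfolding block_match_def by blast
    moreover have "0 < s" "s < length u"
      by (simp_all add: s_def u_def ws)
    ultimately show False
      using no by blast
  qed
qed


section \<open>Reading an encoding\<close>

fun next_phase :: "phase \<Rightarrow> rp_symbol \<Rightarrow> phase" where
  "next_phase Skip x = (if x = Mandatory_Tag then First else if x = Minus then Reject else Skip)"
| "next_phase First x = (if x = Sep then Second else First)"
| "next_phase Second x = (if x = Sep then Skip else Second)"
| "next_phase q x = q"

text \<open>
  The second component is the word written so far. The separator that ends an endpoint is copied along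
  with it and serves as the end of its block.
\<close>

fun read_symbol :: "phase \<times> rp_symbol list \<Rightarrow> rp_symbol \<Rightarrow> phase \<times> rp_symbol list" where
  "read_symbol (q, v) x = (next_phase q x, if q \<in> {First, Second} then v @ [x] else v)"

lemma set_enc_nat: "set (enc_nat n) \<subseteq> {Bit0, Bit1}"
proof (induction n rule: less_induct)
  case (less n)
  show ?case
    by (subst enc_nat.simps) (use less [of "n div 2"] in auto)
qed

definition bits_value :: "rp_symbol list \<Rightarrow> nat" where
  "bits_value xs = foldl (\<lambda>n b. 2 * n + of_bool (b = Bit1)) 0 xs"

lemma bits_value_enc_nat: "bits_value (enc_nat n) = n"
proof (induction n rule: less_induct)
  case (less n)
  show ?case
  proof (cases "n < 2")
    case True
    then have "n = 0 \<or> n = 1"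
      by auto
    then show ?thesis
      by (subst enc_nat.simps) (auto simp: bits_value_def)
  next
    case False
    then have "bits_value (enc_nat (n div 2)) = n div 2"
      using less by simp
    then show ?thesis
      using False by (subst enc_nat.simps) (auto simp: bits_value_def)
  qed
qed

lemma inj_enc_nat: "inj enc_nat"
  by (metis bits_value_enc_nat injI)

lemma read_skipped:
  "Mandatory_Tag \<notin> set xs \<Longrightarrow> Minus \<notin> set xs \<Longrightarrow> foldl read_symbol (Skip, v) xs = (Skip, v)"
  by (induction xs) auto

lemma read_copied:
  "q \<in> {First, Second} \<Longrightarrow> Sep \<notin> set xs \<Longrightarrow> foldl read_symbol (q, v) xs = (q, v @ xs)"
  by (induction xs arbitrary: v) auto

lemma read_Reject [simp]: "foldl read_symbol (Reject, v) xs = (Reject, v)"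
  by (induction xs) auto

lemma Minus_in_enc_rat: "Minus \<in> set (enc_rat r) \<longleftrightarrow> r < 0"
proof -
  obtain a b where q: "quotient_of r = (a, b)"
    by (cases "quotient_of r")
  have "r = of_int a / of_int b" "0 < b"
    using q by (auto simp: quotient_of_div quotient_of_denom_pos)
  then have "r < 0 \<longleftrightarrow> a < 0"
    by (simp add: divide_less_0_iff)
  then show ?thesis
    using set_enc_nat [of "nat \<bar>a\<bar>"] set_enc_nat [of "nat b"] by (auto simp: enc_rat_def q)
qed

lemma Mandatory_Tag_notin_enc_rat: "Mandatory_Tag \<notin> set (enc_rat r)"
  using set_enc_nat by (fastforce simp: enc_rat_def split: prod.split)

lemma read_enc_rat:
  "foldl read_symbol (Skip, v) (enc_rat r) = (if r < 0 then Reject else Skip, v)"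
proof (cases "r < 0")
  case True
  then obtain xs ys where "enc_rat r = xs @ Minus # ys" "Minus \<notin> set xs"
    using Minus_in_enc_rat by (meson split_list_first)
  moreover from this have "Mandatory_Tag \<notin> set xs"
    using Mandatory_Tag_notin_enc_rat [of r] by auto
  ultimately show ?thesis
    using True by (simp add: read_skipped)
next
  case False
  then show ?thesis
    using Minus_in_enc_rat Mandatory_Tag_notin_enc_rat by (simp add: read_skipped)
qed

lemma read_enc_edge:
  assumes valid: "rp_valid J" and mand: "follower_edges J = mandatory J" and e: "{a, b} \<in> edges J"
  shows "foldl read_symbol (Skip, v) (enc_edge J (a, b)) =
    (if {a, b} \<in> mandatory J then
       (if weight J {a, b} < 0 then Reject else Skip, v @ blocks (map enc_nat [a, b]))
     else (Skip, v))"
proof (cases "{a, b} \<in> mandatory J")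
  case True
  then have "edge_tag J {a, b} = Mandatory_Tag"
    using valid mand by (auto simp: edge_tag_def rp_valid_def)
  moreover have "Sep \<notin> set (enc_nat a)" "Sep \<notin> set (enc_nat b)"
    using set_enc_nat [of a] set_enc_nat [of b] by auto
  ultimately show ?thesis
    using True mand by (simp add: read_copied read_enc_rat)
next
  case False
  then have "edge_tag J {a, b} = Leader_Tag"
    using valid mand e by (auto simp: edge_tag_def rp_valid_def)
  then have "set (enc_edge J (a, b)) \<subseteq> {Leader_Tag, Sep, Bit0, Bit1}"
    using False mand set_enc_nat [of a] set_enc_nat [of b] by auto
  then show ?thesis
    using False by (subst read_skipped) auto
qed

text \<open>
  After a \<open>Reject\<close> nothing is claimed about the word written so far, because the machine has stopped
  in the middle of the input.
\<close>

lemma read_enc_edges: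
  assumes valid: "rp_valid J" and mand: "follower_edges J = mandatory J"
    and "(\<lambda>(a, b). {a, b}) ` set es \<subseteq> edges J"
  defines "R \<equiv> mandatory J \<inter> (\<lambda>(a, b). {a, b}) ` set es"
  shows "if \<forall>e\<in>R. 0 \<le> weight J e
    then foldl read_symbol (Skip, v) (concat (map (enc_edge J) es)) =
      (Skip, v @ blocks (map enc_nat (endpoints J es)))
    else fst (foldl read_symbol (Skip, v) (concat (map (enc_edge J) es))) = Reject"
  using assms(3) unfolding R_def
proof (induction es arbitrary: v)
  case (Cons e es)
  obtain a b where e: "e = (a, b)"
    by (cases e)
  have "{a, b} \<in> edges J"
    using Cons.prems e by simp
  note step = read_enc_edge [OF valid mand this, of v]
  show ?case
  proof (cases "{a, b} \<in> mandatory J \<and> weight J {a, b} < 0")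
    case True
    then show ?thesis
      using step e by force
  next
    case False
    then have "foldl read_symbol (Skip, v) (enc_edge J (a, b)) =
        (Skip, v @ blocks (map enc_nat (endpoints J [(a, b)])))"
      using step by simp
    moreover have "(\<forall>e\<in>mandatory J \<inter> (\<lambda>(a, b). {a, b}) ` set (e # es). 0 \<le> weight J e) \<longleftrightarrow>
        (\<forall>e\<in>mandatory J \<inter> (\<lambda>(a, b). {a, b}) ` set es. 0 \<le> weight J e)"
      using False e by auto
    moreover have "blocks (map enc_nat (endpoints J (e # es))) =
        blocks (map enc_nat (endpoints J [(a, b)])) @ blocks (map enc_nat (endpoints J es))"
      by (simp add: e)
    ultimately show ?thesis
      using Cons.IH [of "v @ blocks (map enc_nat (endpoints J [(a, b)]))"] Cons.prems
      by (simp only: list.map concat.simps foldl_append e append.assoc) simp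
  qed
qed simp

lemma read_encoding:
  assumes valid: "rp_valid J" and mand: "follower_edges J = mandatory J" and w: "rp_encodes J w"
  obtains ws where
    "\<forall>x\<in>set ws. Sep \<notin> set x" and
    "distinct ws \<longleftrightarrow> pairwise disjnt (mandatory J)" and
    "if \<forall>e\<in>mandatory J. 0 \<le> weight J e
     then foldl read_symbol (Skip, v) w = (Skip, v @ blocks ws)
     else fst (foldl read_symbol (Skip, v) w) = Reject"
proof -
  from w obtain vs es where dist: "distinct (map (\<lambda>(u, v). {u, v}) es)"
    and es: "(\<lambda>(u, v). {u, v}) ` set es = edges J"
    and w: "w = concat (map enc_vertex vs) @ concat (map (enc_edge J) es)"
    unfolding rp_encodes_def by blast
  have R: "mandatory J \<inter> edges J = mandatory J"
    using valid by (auto simp: rp_valid_def)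
  have loop: "\<forall>(u, v)\<in>set es. u \<noteq> v"
  proof safe
    fix u assume "(u, u) \<in> set es"
    then have "{u, u} \<in> edges J"
      using es by force
    then have "card {u, u} = 2"
      using valid unfolding rp_valid_def by blast
    then show False
      by simp
  qed
  have vertices: "foldl read_symbol (Skip, v) (concat (map enc_vertex vs)) = (Skip, v)"
  proof (rule read_skipped)
    have "set (enc_vertex x) \<subseteq> {Vertex_Tag, Bit0, Bit1}" for x
      using set_enc_nat [of x] by (auto simp: enc_vertex_def)
    then have "set (concat (map enc_vertex vs)) \<subseteq> {Vertex_Tag, Bit0, Bit1}"
      by auto
    then show "Mandatory_Tag \<notin> set (concat (map enc_vertex vs))"
      "Minus \<notin> set (concat (map enc_vertex vs))"
      by auto
  qed
  show thesis
  proof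
    show "\<forall>x\<in>set (map enc_nat (endpoints J es)). Sep \<notin> set x"
      using set_enc_nat by fastforce
    show "distinct (map enc_nat (endpoints J es)) \<longleftrightarrow> pairwise disjnt (mandatory J)"
      using distinct_endpoints_iff [OF dist loop, of J] inj_on_subset [OF inj_enc_nat subset_UNIV] es R
      by (simp add: distinct_map)
    show "if \<forall>e\<in>mandatory J. 0 \<le> weight J e
      then foldl read_symbol (Skip, v) w = (Skip, v @ blocks (map enc_nat (endpoints J es)))
      else fst (foldl read_symbol (Skip, v) w) = Reject"
      using read_enc_edges [OF valid mand, of es v] vertices es R unfolding w by simp
  qed
qed

lemma length_read: "length (snd (foldl read_symbol (q, v) xs)) \<le> length v + length xs"
proof (induction xs arbitrary: q v)
  case (Cons x xs)
  then show ?case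
    using Cons.IH [of "next_phase q x" v] Cons.IH [of "next_phase q x" "v @ [x]"]
    by (auto intro: le_SucI)
qed simp


section \<open>The machine\<close>

primrec code :: "phase \<Rightarrow> nat" where
  "code Start = 0"
| "code Skip = 1"
| "code First = 2"
| "code Second = 3"
| "code Rewind = 4"
| "code Shift = 5"
| "code Unaligned = 6"
| "code Aligned = 7"
| "code Accept = 8"
| "code Reject = 9"

lemma inj_code: "inj code"
proof
  fix p q assume "code p = code q"
  then show "p = q"
    by (cases p; cases q) simp_all
qed

lemma code_less: "code p < 10"
  by (cases p) simp_all

text \<open>
  The first tape holds the input and the other two the written word. Heads two and three keep a fixed
  distance \<open>s\<close> during a sweep and while it is undone; \<open>Rewind\<close> uses the blank to the left of the word
  on the second tape to find the position from which \<open>Shift\<close> increases \<open>s\<close> by one. The first sweep back,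
  after the reading, has \<open>s = 0\<close>. When \<open>s\<close> has reached the length of the word, all shifts have been tried.
\<close>

fun transition :: "phase \<Rightarrow> rp_symbol option \<Rightarrow> rp_symbol option \<Rightarrow> rp_symbol option \<Rightarrow>
    phase \<times> (rp_symbol option \<times> direction) list" where
  "transition Start a b c = (Skip, [(a, Stay), (Some Sep, Go_Right), (Some Sep, Go_Right)])"
| "transition Rewind a b c =
    (if b = None then (Shift, [(a, Stay), (b, Go_Right), (c, Go_Right)])
     else (Rewind, [(a, Stay), (b, Go_Left), (c, Go_Left)]))"
| "transition Shift a b c =
    (if c = None then (Accept, [(a, Stay), (b, Stay), (c, Stay)])
     else (Unaligned, [(a, Stay), (b, Stay), (c, Go_Right)]))"
| "transition q a b c =
    (if q \<in> {Skip, First, Second} then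
       (case a of
          None \<Rightarrow> (Rewind, [(a, Stay), (b, Go_Left), (c, Go_Left)])
        | Some x \<Rightarrow> (next_phase q x,
            if q \<in> {First, Second} then [(a, Go_Right), (a, Go_Right), (a, Go_Right)]
            else [(a, Go_Right), (b, Stay), (c, Stay)]))
     else
       (case (b, c) of
          (Some x, Some y) \<Rightarrow> (compare q (x, y), [(a, Stay), (b, Go_Right), (c, Go_Right)])
        | _ \<Rightarrow> (Rewind, [(a, Stay), (b, Go_Left), (c, Go_Left)])))"

definition response_tm :: "rp_symbol tm" where
  "response_tm =
    \<lparr>tm_tapes = 3, tm_states = 10, tm_start = code Start, tm_accept = code Accept,
     tm_reject = code Reject,
     tm_trans = (\<lambda>q xs. map_prod code id (transition (inv code q) (xs ! 0) (xs ! 1) (xs ! 2)))\<rparr>"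

lemma length_transition: "length (snd (transition q a b c)) = 3"
  by (cases q) (auto split: option.split)

lemma wf_response_tm: "wf_tm response_tm"
  using length_transition code_less by (simp add: wf_tm_def response_tm_def)

abbreviation run :: "nat \<Rightarrow> rp_symbol config \<Rightarrow> rp_symbol config" where
  "run n \<equiv> tm_step response_tm ^^ n"

lemma run_trans: "run m c = c' \<Longrightarrow> run n c' = c'' \<Longrightarrow> run (m + n) c = c''"
  by (simp add: funpow_add add.commute [of m])

lemma run_Suc: "run (Suc n) c = run n (tm_step response_tm c)"
  by (simp add: funpow_swap1)

definition cell :: "'s list \<Rightarrow> int \<Rightarrow> 's option" where
  "cell u h = (if 0 \<le> h \<and> h < int (length u) then Some (u ! nat h) else None)"

definition tape_of :: "'s list \<Rightarrow> int \<Rightarrow> 's tape" where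
  "tape_of u h = (cell u, h)"

definition conf :: "phase \<Rightarrow> rp_symbol list \<Rightarrow> int \<Rightarrow> rp_symbol list \<Rightarrow> int \<Rightarrow> int \<Rightarrow>
    rp_symbol config" where
  "conf q w h u i j = (code q, [tape_of w h, tape_of u i, tape_of u j])"

lemma scanned_tape_of [simp]: "scanned (tape_of u h) = cell u h"
  by (simp add: tape_of_def)

lemma act_keep [simp]:
  "cell u h = a \<Longrightarrow> act (a, m) (tape_of u h) = tape_of u (move_head m h)"
  by (auto simp: tape_of_def)

lemma act_append:
  "h = int (length u) \<Longrightarrow> act (Some x, m) (tape_of u h) = tape_of (u @ [x]) (move_head m h)"
  by (auto simp: tape_of_def cell_def nth_append fun_eq_iff)

lemma tm_step_conf:
  assumes "q \<noteq> Accept" "q \<noteq> Reject"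
  shows "tm_step response_tm (conf q w h u i j) =
    (case transition q (cell w h) (cell u i) (cell u j) of
       (q', as) \<Rightarrow> (code q', map2 act as [tape_of w h, tape_of u i, tape_of u j]))"
proof -
  have "code q \<noteq> 8" "code q \<noteq> 9"
    using assms by (cases q; simp)+
  then show ?thesis
    by (simp add: conf_def response_tm_def inv_f_f [OF inj_code] split: prod.split)
qed

lemma run_Reject: "fst (run n (conf Reject w h u i j)) = code Reject"
proof -
  have "tm_step response_tm (conf Reject w h u i j) = conf Reject w h u i j"
    by (simp add: conf_def response_tm_def)
  then have "run n (conf Reject w h u i j) = conf Reject w h u i j"
    by (induction n) simp_all
  then show ?thesis
    by (simp add: conf_def)
qed

text \<open>
  Starting at \<open>i - 1\<close> lets the case \<open>i = 0\<close> describe the second head on the blank to the left of the word.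
  From there both heads move one cell to the right.
\<close>

lemma run_rewind:
  "i \<le> length u \<Longrightarrow>
    run (Suc i) (conf Rewind w h u (int i - 1) (int (s + i) - 1)) = conf Shift w h u 0 (int s)"
proof (induction i)
  case 0
  then show ?case
    by (subst run_Suc, subst tm_step_conf) (auto simp: conf_def cell_def)
next
  case (Suc i)
  have "tm_step response_tm (conf Rewind w h u (int (Suc i) - 1) (int (s + Suc i) - 1)) =
      conf Rewind w h u (int i - 1) (int (s + i) - 1)"
    using Suc.prems by (subst tm_step_conf) (auto simp: conf_def cell_def [of u "int i"])
  then show ?case
    using Suc by (simp only: run_Suc)
qed

lemma run_reading:
  assumes "q \<in> {Skip, First, Second}"
  shows "case foldl read_symbol (q, v) xs of (q', v') \<Rightarrow>
    if q' = Reject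
    then fst (run (length xs)
      (conf q (ps @ xs) (int (length ps)) v (int (length v)) (int (length v)))) = code Reject
    else q' \<in> {Skip, First, Second} \<and> run (length xs)
      (conf q (ps @ xs) (int (length ps)) v (int (length v)) (int (length v))) =
      conf q' (ps @ xs) (int (length ps + length xs)) v' (int (length v')) (int (length v'))"
  using assms
proof (induction xs arbitrary: q v ps)
  case (Cons x xs)
  let ?c = "conf q (ps @ x # xs) (int (length ps)) v (int (length v)) (int (length v))"
  let ?q = "next_phase q x" and ?v = "if q \<in> {First, Second} then v @ [x] else v"
  have cell: "cell (ps @ x # xs) (int (length ps)) = Some x"
    by (simp add: cell_def)
  have step: "tm_step response_tm ?c =
      conf ?q (ps @ x # xs) (int (length ps) + 1) ?v (int (length ?v)) (int (length ?v))"
    using Cons.prems cell by (subst tm_step_conf) (auto simp: conf_def act_append add.commute)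
  show ?case
  proof (cases "?q = Reject")
    case True
    have "fst (run (length (x # xs)) ?c) = code Reject"
      (* The head stays behind the rest of the input, but the state does not change any more. *)
      unfolding list.size add_Suc_right add_0_right run_Suc step True by (rule run_Reject)
    then show ?thesis
      using True by simp
  next
    case False
    then have "?q \<in> {Skip, First, Second}"
      using Cons.prems by (auto split: if_splits)
    note IH = Cons.IH [OF this, where v = ?v and ps = "ps @ [x]"]
    have fold: "foldl read_symbol (q, v) (x # xs) = foldl read_symbol (?q, ?v) xs"
      by simp
    have eq: "(ps @ [x]) @ xs = ps @ x # xs"
      "length (ps @ [x]) + length xs = length ps + length (x # xs)"
      by simp_all
    have run: "run (length (x # xs)) ?c = run (length xs)
        (conf ?q (ps @ x # xs) (int (length (ps @ [x]))) ?v (int (length ?v)) (int (length ?v)))"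
      unfolding list.size add_Suc_right add_0_right run_Suc step by (simp add: add.commute)
    show ?thesis
      using IH unfolding fold run eq .
  qed
qed auto

text \<open>
  The suffix of the zipped word from \<open>i\<close> on is what a sweep at distance \<open>s\<close> has yet to read. Head three is
  \<open>s\<close> cells ahead, so the blank that ends the sweep is met by this head.
\<close>

lemma run_sweep:
  assumes "q \<in> {Unaligned, Aligned}" "s + i \<le> length u"
  shows "let zs = drop i (zip u (drop s u)); c = conf q w h u (int i) (int (s + i)) in
    if foldl compare q zs = Reject
    then fst (run (length u - (s + i)) c) = code Reject
    else run (Suc (length u - (s + i))) c =
      conf Rewind w h u (int (length u - s) - 1) (int (length u) - 1)"
  using assms
proof (induction "length u - (s + i)" arbitrary: i q)
  case 0
  then have "cell u (int (s + i)) = None"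
    by (simp add: cell_def)
  then show ?case
    using 0 by (auto simp: tm_step_conf split: option.split) (auto simp: conf_def algebra_simps)
next
  case (Suc n)
  then have less: "s + i < length u"
    by simp
  let ?q = "compare q (u ! i, u ! (s + i))"
  have zs: "drop i (zip u (drop s u)) = (u ! i, u ! (s + i)) # drop (Suc i) (zip u (drop s u))"
    using less by (subst Cons_nth_drop_Suc [symmetric]) auto
  have "cell u (int i) = Some (u ! i)" "cell u (int (s + i)) = Some (u ! (s + i))"
    using less by (auto simp: cell_def nat_int_add)
  then have step: "tm_step response_tm (conf q w h u (int i) (int (s + i))) =
      conf ?q w h u (int (Suc i)) (int (s + Suc i))"
    using Suc.prems by (subst tm_step_conf) (auto simp: conf_def add_ac)
  have n: "length u - (s + i) = Suc (length u - (s + Suc i))"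
    using less by simp
  show ?case
  proof (cases "?q = Reject")
    case True
    then show ?thesis
      unfolding zs n run_Suc Let_def step by (simp add: run_Reject del: code.simps)
  next
    case False
    then have "?q \<in> {Unaligned, Aligned}"
      using Suc.prems by (auto split: if_splits)
    from Suc.hyps(1) [OF _ this, of "Suc i"] Suc.hyps(2) less
    have "let zs = drop (Suc i) (zip u (drop s u));
        c = conf ?q w h u (int (Suc i)) (int (s + Suc i)) in
      if foldl compare ?q zs = Reject
      then fst (run (length u - (s + Suc i)) c) = code Reject
      else run (Suc (length u - (s + Suc i))) c =
        conf Rewind w h u (int (length u - s) - 1) (int (length u) - 1)"
      by simp
    then show ?thesis
      unfolding zs n Let_def foldl.simps run_Suc [of _ "conf q w h u (int i) (int (s + i))"] step .
  qed
qed

text \<open>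
  A round from one shift to the next consists of a shift step, a sweep and its undoing, which take
  at most \<open>2 * length u + 3\<close> steps together.
\<close>

lemma run_shifts:
  assumes "s \<le> length u"
  shows "\<exists>t \<le> (length u - s) * (2 * length u + 3) + 1.
    fst (run t (conf Shift w h u 0 (int s))) = code
      (if \<forall>s'. s < s' \<and> s' < length u \<longrightarrow> \<not> block_match (zip u (drop s' u)) then Accept else Reject)"
  using assms
proof (induction "length u - s" arbitrary: s)
  case 0
  then have "fst (run 1 (conf Shift w h u 0 (int s))) = code Accept"
    by (simp add: tm_step_conf cell_def)
  then show ?case
    using 0 by (intro exI [of _ 1]) auto
next
  case (Suc n)
  let ?c = "conf Shift w h u 0 (int s)"
  let ?bound = "\<lambda>s. (length u - s) * (2 * length u + 3) + 1"
  have less: "s < length u"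
    using Suc by simp
  have split: "(\<forall>s'. s < s' \<and> s' < length u \<longrightarrow> \<not> block_match (zip u (drop s' u))) \<longleftrightarrow>
      \<not> block_match (zip u (drop (Suc s) u)) \<and>
      (\<forall>s'. Suc s < s' \<and> s' < length u \<longrightarrow> \<not> block_match (zip u (drop s' u)))"
  proof -
    have "(\<forall>s'. s < s' \<and> s' < n \<longrightarrow> P s') \<longleftrightarrow> P (Suc s) \<and> (\<forall>s'. Suc s < s' \<and> s' < n \<longrightarrow> P s')"
      if "\<not> Suc s < n \<Longrightarrow> P (Suc s)" for P n
      using that by (metis Suc_lessI lessI less_trans)
    moreover have "\<not> Suc s < length u \<Longrightarrow> \<not> block_match (zip u (drop (Suc s) u))"
      by (simp add: block_match_def)
    ultimately show ?thesis .
  qed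
  have bound: "?bound s = 2 * length u + 3 + ?bound (Suc s)"
    using less by (simp add: Suc_diff_Suc [symmetric])
  have shift: "run 1 ?c = conf Unaligned w h u (int 0) (int (Suc s + 0))"
    using less by (simp add: tm_step_conf cell_def [of u "int s"]) (simp add: conf_def add.commute)
  note sweep = run_sweep [of Unaligned "Suc s" 0 u w h, unfolded Let_def]
  show ?case
  proof (cases "block_match (zip u (drop (Suc s) u))")
    case True
    then have "fst (run (1 + (length u - Suc s)) ?c) = code Reject"
      using sweep less run_trans [OF shift refl]
      by (simp add: foldl_compare_eq_Reject_iff)
    moreover have "1 + (length u - Suc s) \<le> ?bound s"
      unfolding bound by simp
    ultimately show ?thesis
      unfolding split using True
      by (intro exI [of _ "1 + (length u - Suc s)"]) (simp only: simp_thms if_False)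
  next
    case False
    have "run (1 + Suc (length u - Suc s)) ?c =
        conf Rewind w h u (int (length u - Suc s) - 1) (int (length u) - 1)"
      using False sweep less run_trans [OF shift, of "Suc (length u - Suc s)"]
      by (simp add: foldl_compare_eq_Reject_iff)
    moreover have "run (Suc (length u - Suc s)) (conf Rewind w h u (int (length u - Suc s) - 1)
        (int (length u) - 1)) = conf Shift w h u 0 (int (Suc s))"
      using run_rewind [of "length u - Suc s" u w h "Suc s"] less by simp
    ultimately have "run ((1 + Suc (length u - Suc s)) + Suc (length u - Suc s)) ?c =
        conf Shift w h u 0 (int (Suc s))"
      by (rule run_trans)
    note round = run_trans [OF this refl]
    obtain t where t: "t \<le> ?bound (Suc s)"
      "fst (run t (conf Shift w h u 0 (int (Suc s)))) = code
        (if \<forall>s'. Suc s < s' \<and> s' < length u \<longrightarrow> \<not> block_match (zip u (drop s' u))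
         then Accept else Reject)"
    proof -
      have "n = length u - Suc s" "Suc s \<le> length u"
        using Suc.hyps(2) less by simp_all
      then show thesis
        using Suc.hyps(1) [of "Suc s"] that by blast
    qed
    show ?thesis
      unfolding split
    proof (intro exI conjI)
      show "(1 + Suc (length u - Suc s)) + Suc (length u - Suc s) + t \<le> ?bound s"
        unfolding bound using t(1) by simp
    qed (use round t(2) False in simp)
  qed
qed

lemma tm_init_response_tm: "tm_init response_tm w = conf Start w 0 [] 0 0"
  by (auto simp: tm_init_def response_tm_def conf_def tape_of_def input_tape_def blank_tape_def
      cell_def numeral_2_eq_2)

lemma response_tm_correct:
  assumes valid: "rp_valid J" and mand: "follower_edges J = mandatory J" and w: "rp_encodes J w"
  shows "\<exists>t \<le> 2 * (length w + 5)\<^sup>2. state_after response_tm w t =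
    code (if rp_yes J then Accept else Reject)"
proof -
  obtain ws where sep: "\<forall>x\<in>set ws. Sep \<notin> set x"
    and dist: "distinct ws \<longleftrightarrow> pairwise disjnt (mandatory J)"
    and read: "if \<forall>e\<in>mandatory J. 0 \<le> weight J e
      then foldl read_symbol (Skip, [Sep]) w = (Skip, [Sep] @ blocks ws)
      else fst (foldl read_symbol (Skip, [Sep]) w) = Reject"
    using read_encoding [OF valid mand w] by metis
  let ?init = "tm_init response_tm w"
  let ?N = "int (length w)"
  have start: "run 1 ?init = conf Skip w 0 [Sep] 1 1"
    using act_append [of 0 "[]" Sep Go_Right]
    by (simp add: tm_init_response_tm tm_step_conf) (simp add: conf_def)
  note reading = run_reading [of Skip, where v = "[Sep]" and xs = w and ps = "[]", simplified]
  show ?thesis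
  proof (cases "\<forall>e\<in>mandatory J. 0 \<le> weight J e")
    case True
    define u where "u = Sep # blocks ws"
    have fold: "foldl read_symbol (Skip, [Sep]) w = (Skip, u)"
      using True read by (simp add: u_def)
    have "length u \<le> length w + 1"
      using length_read [of Skip "[Sep]" w] fold by simp
    have "run (length w) (conf Skip w 0 [Sep] 1 1) = conf Skip w ?N u (int (length u)) (int (length u))"
      using reading fold by simp
    note run_trans [OF start this]
    moreover have "run 1 (conf Skip w ?N u (int (length u)) (int (length u))) =
        conf Rewind w ?N u (int (length u) - 1) (int (0 + length u) - 1)"
      by (simp add: tm_step_conf cell_def [of w]) (simp add: conf_def cell_def)
    ultimately have "run (1 + length w + 1) ?init =
        conf Rewind w ?N u (int (length u) - 1) (int (0 + length u) - 1)"
      by (rule run_trans)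
    then have "run (1 + length w + 1 + Suc (length u)) ?init = conf Shift w ?N u 0 (int 0)"
      by (rule run_trans) (rule run_rewind, simp)
    note prep = run_trans [OF this refl]
    obtain t where t: "t \<le> (length u - 0) * (2 * length u + 3) + 1"
      "fst (run t (conf Shift w ?N u 0 (int 0))) = code
        (if \<forall>s'. 0 < s' \<and> s' < length u \<longrightarrow> \<not> block_match (zip u (drop s' u)) then Accept else Reject)"
      using run_shifts [of 0 u w ?N] by blast
    have yes: "rp_yes J \<longleftrightarrow>
        (\<forall>s'. 0 < s' \<and> s' < length u \<longrightarrow> \<not> block_match (zip u (drop s' u)))"
      using rp_yes_iff [OF valid mand] True dist distinct_iff_no_shift_match [OF sep]
      unfolding u_def by blast
    have "t \<le> (length w + 1) * (2 * (length w + 1) + 3) + 1"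
      using t(1) \<open>length u \<le> length w + 1\<close>
      by (elim order_trans) (intro add_mono mult_mono, auto)
    then have "1 + length w + 1 + Suc (length u) + t \<le> 2 * (length w + 5)\<^sup>2"
      using \<open>length u \<le> length w + 1\<close> by (simp add: power2_eq_square algebra_simps)
    moreover have "state_after response_tm w (1 + length w + 1 + Suc (length u) + t) =
        code (if rp_yes J then Accept else Reject)"
      unfolding state_after_def prep yes by (rule t(2))
    ultimately show ?thesis
      by blast
  next
    case False
    then obtain v where "foldl read_symbol (Skip, [Sep]) w = (Reject, v)"
      using read by (metis prod.collapse)
    then have "fst (run (length w) (conf Skip w 0 [Sep] 1 1)) = code Reject"
      using reading by simp
    then have "state_after response_tm w (1 + length w) = code Reject"
      using run_trans [OF start refl] by (simp add: state_after_def)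
    moreover have "1 + length w \<le> 2 * (length w + 5)\<^sup>2"
      by (simp add: power2_eq_square algebra_simps)
    moreover have "\<not> rp_yes J"
      using False rp_yes_iff [OF valid mand] by blast
    ultimately show ?thesis
      by (auto intro!: exI [of _ "1 + length w"])
  qed
qed

theorem proposition3p1:
  "poly_time_solvable
     {J :: nat rp_instance. rp_valid J \<and> follower_edges J = mandatory J}
     rp_encodes rp_yes"
proof -
  have "poly [:50, 20, 2:] n = 2 * (n + 5)\<^sup>2" for n :: nat
    by (simp add: power2_eq_square algebra_simps)
  moreover have "tm_accept response_tm = code Accept" "tm_reject response_tm = code Reject"
    by (simp_all add: response_tm_def)
  ultimately show ?thesis
    unfolding poly_time_solvable_def
    using wf_response_tm response_tm_correct
    by (intro exI [of _ response_tm] exI [of _ "[:50, 20, 2:]"])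
      (simp only: if_distrib mem_Collect_eq, blast)
qed

end
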